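(* Let $k\ge0$ be an integer, put $k_0=2k+1$, $\phi=(1+\sqrt5)/2$, $u=\phi^{(2k+1)/2}$, $t=u+1/u$ and $t_0=t^2-2$. Then $t_0=f_{2k+1}\sqrt5$. Define sequences by $$H_1=1,\quad H_2=t_0,\quad H_n=t_0H_{n-1}-H_{n-2};\qquad K_0=1,\quad K_1=t_0+1,\quad K_n=t_0K_{n-1}-K_{n-2}.$$ Then $$\mathcal{L}(1/\phi^{2k+1})=\sum_{n=1}^{\infty}\mathcal{L}\left(\frac{1}{t^2H_n^2}\right)+\sum_{n=1}^{\infty}\mathcal{L}\left(\frac{1}{K_n^2}\right),$$ and moreover $$\sum_{n=1}^{\infty}\mathcal{L}\left(\frac{1}{t^2H_n^2}\right)=\sum_{n=1}^{\infty}\mathcal{L}\left(\left(\frac{l_{k_0}}{t\cdot l_{(2n-1)k_0}}\right)^2\right)+\sum_{n=1}^{\infty}\mathcal{L}\left(\left(\frac{l_{k_0}}{\sqrt5\,t\cdot f_{2nk_0}}\right)^2\right),$$ $$\sum_{n=1}^{\infty}\mathcal{L}\left(\frac{1}{K_n^2}\right)=\sum_{n=1}^{\infty}\mathcal{L}\left(\left(\frac{l_{k_0}}{l_{(2n-1)k_0}+\sqrt5f_{2nk_0}}\right)^2\right)+\sum_{n=2}^{\infty}\mathcal{L}\left(\left(\frac{l_{k_0}}{l_{(2n-1)k_0}+\sqrt5f_{2(n-1)k_0}}\right)^2\right).$$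
   Context: The Rogers dilogarithm is the function on $[0,1]$ given by $\mathcal{L}(z)=\mathrm{Li}_2(z)+\frac12\log|z|\log(1-z)$, where $\mathrm{Li}_2(z)=\sum_{n\ge1}z^n/n^2$, with $\mathcal{L}(0)=0$ and $\mathcal{L}(1)=\pi^2/6$. Fibonacci numbers: $f_0=0$, $f_1=1$, $f_n=f_{n-1}+f_{n-2}$. Lucas numbers: $l_0=2$, $l_1=1$, $l_n=l_{n-1}+l_{n-2}$. *)

theory Defs
  imports "HOL-Analysis.Analysis" "HOL-Number_Theory.Fib"
begin

definition Li2 :: "real \<Rightarrow> real" where
  "Li2 z = (\<Sum>n. z ^ Suc n / (real (Suc n))\<^sup>2)"

text \<open>The Rogers dilogarithm is only meant on the interval from 0 to 1;
  values elsewhere carry no meaning.\<close>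

definition rogers_dilog :: "real \<Rightarrow> real" where
  "rogers_dilog z =
     (if z = 0 then 0
      else if z = 1 then pi\<^sup>2 / 6
      else Li2 z + 1 / 2 * ln \<bar>z\<bar> * ln (1 - z))"

fun lucas :: "nat \<Rightarrow> nat" where
  "lucas 0 = 2"
| "lucas (Suc 0) = 1"
| "lucas (Suc (Suc n)) = lucas (Suc n) + lucas n"

end

(*
  With p = 1 / phi^k0 one has t^2 H_n^2 = 1 / a_(2n) and K_n^2 = 1 / a_(2n+1), where
  a_m = p^(m-1) (1 - p)^2 / (1 - p^m)^2. For z = p^(m-1), the identity
  L(z (1 - p)^2 / (1 - p z)^2) = G(p z) - G(z) with
  G(z) = L((1 - z) / (1 - p z)) + L(p (1 - z) / (1 - p z)) makes the sum of all L(a_m),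
  m >= 2, telescope to G(0) - G(p) = L(p); the identity holds because both sides vanish at
  z = 0 and have the same derivative. All terms are nonnegative, so the series may be split
  by the residue of m modulo 2, and then modulo 4; Binet's formulas for k0 odd identify the
  terms of the four subseries.
*)

theory Submission
  imports Defs "HOL-Real_Asymp.Real_Asymp"
begin

section \<open>Continuity, sign and derivative of the Rogers dilogarithm\<close>

text \<open>The bound 1/n^2 holds up to \<open>z = 1\<close>, on the boundary of the disc of
  convergence, so the Weierstrass M-test gives uniform convergence there as well.\<close>

lemma continuous_on_Li2: "continuous_on {0..1} Li2"
proof -
  have s: "summable (\<lambda>n. 1 / (real (Suc n))\<^sup>2)"
    using inverse_squares_sums by (simp add: sums_iff add.commute)
  have b: "norm (z ^ Suc n / (real (Suc n))\<^sup>2) \<le> 1 / (real (Suc n))\<^sup>2"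
    if "z \<in> {0..1}" for z n
    using that power_le_one[of z "Suc n"]
    by (auto simp: abs_mult power_abs divide_right_mono simp del: power_Suc of_nat_Suc)
  have "uniform_limit {0..1} (\<lambda>n z. \<Sum>i<n. z ^ Suc i / (real (Suc i))\<^sup>2)
      (\<lambda>z. \<Sum>i. z ^ Suc i / (real (Suc i))\<^sup>2) sequentially"
    by (rule Weierstrass_m_test[OF b s])
  then have "continuous_on {0..1} (\<lambda>z::real. \<Sum>i. z ^ Suc i / (real (Suc i))\<^sup>2)"
    by (rule uniform_limit_theorem[rotated]) (auto intro!: always_eventually continuous_intros)
  then show ?thesis
    by (simp add: Li2_def[abs_def])
qed

lemma Li2_has_field_derivative:
  assumes "0 < z" "z < 1"
  shows "(Li2 has_field_derivative (- ln (1 - z) / z)) (at z)"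
proof -
  have *: "1 / (real (Suc n))\<^sup>2 * real (Suc n) * x ^ n = x ^ n / real (Suc n)" for x n
    by (simp add: power2_eq_square)
  have smm: "summable (\<lambda>n. x ^ n / real (Suc n))" if "x \<in> {-1<..<1}" for x :: real
  proof (rule summable_comparison_test')
    show "summable (\<lambda>n. \<bar>x\<bar> ^ n)" using that by (intro summable_geometric) auto
    show "norm (x ^ n / real (Suc n)) \<le> \<bar>x\<bar> ^ n" for n
      by (simp add: power_abs divide_le_eq mult_le_cancel_left1)
  qed
  have D: "((\<lambda>z. \<Sum>n. 1 / (real (Suc n))\<^sup>2 * z ^ Suc n) has_field_derivative
      (\<Sum>n. 1 / (real (Suc n))\<^sup>2 * real (Suc n) * z ^ n)) (at z)"
    by (rule DERIV_power_series'[of 1]) (unfold *, use assms smm in auto)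
  have "(\<lambda>n. - (z ^ n) / real n) sums ln (1 - z)"
    using ln_series'[of "- z"] assms by simp
  \<comment> \<open>The term at index 0 is a division by zero, hence 0, and drops out when the index
    is shifted.\<close>
  then have "(\<lambda>n. - (z ^ Suc n) / real (Suc n)) sums ln (1 - z)"
    by (subst sums_Suc_iff) simp
  then have "(\<lambda>n. (- 1 / z) * (- (z ^ Suc n) / real (Suc n))) sums ((- 1 / z) * ln (1 - z))"
    by (rule sums_mult)
  then have "(\<lambda>n. z ^ n / real (Suc n)) sums (- ln (1 - z) / z)"
    using assms by (simp add: field_simps del: of_nat_Suc)
  then have "(\<Sum>n. 1 / (real (Suc n))\<^sup>2 * real (Suc n) * z ^ n) = - ln (1 - z) / z"
    unfolding * by (rule sums_unique[symmetric])
  with D show ?thesis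
    by (simp add: Li2_def[abs_def] del: of_nat_Suc)
qed

text \<open>At each endpoint one logarithm is \<open>ln 1 = 0\<close>, and \<open>Li2\<close> has
  the prescribed value (at 1 by the Basel sum), so the separate cases of the definition fit the
  general formula.\<close>

lemma rogers_dilog_eq:
  assumes "z \<in> {0..1}"
  shows "rogers_dilog z = Li2 z + 1 / 2 * (ln z * ln (1 - z))"
proof -
  have "Li2 0 = 0" by (simp add: Li2_def)
  moreover have "Li2 1 = pi\<^sup>2 / 6"
    using inverse_squares_sums by (simp add: Li2_def sums_iff add.commute)
  ultimately show ?thesis
    using assms by (auto simp: rogers_dilog_def)
qed

text \<open>At each endpoint one factor vanishes linearly while the other diverges only
  logarithmically.\<close>

lemma continuous_on_ln_mult_ln: "continuous_on {0..1} (\<lambda>z::real. ln z * ln (1 - z))"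
  unfolding continuous_on_def
proof
  fix x :: real assume x: "x \<in> {0..1}"
  consider "x = 0" | "x = 1" | "0 < x" "x < 1" using x by fastforce
  then show "((\<lambda>z. ln z * ln (1 - z)) \<longlongrightarrow> ln x * ln (1 - x)) (at x within {0..1})"
  proof cases
    case 1
    have "((\<lambda>z::real. ln z * ln (1 - z)) \<longlongrightarrow> 0) (at_right 0)" by real_asymp
    with 1 show ?thesis by (simp add: at_within_Icc_at_right)
  next
    case 2
    have "((\<lambda>z::real. ln z * ln (1 - z)) \<longlongrightarrow> 0) (at_left 1)" by real_asymp
    with 2 show ?thesis by (simp add: at_within_Icc_at_left)
  next
    case 3
    then show ?thesis by (intro tendsto_intros) auto
  qed
qed

lemma continuous_on_rogers_dilog: "continuous_on {0..1} rogers_dilog"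
  by (subst continuous_on_cong[OF refl rogers_dilog_eq])
    (auto intro!: continuous_intros continuous_on_Li2 continuous_on_ln_mult_ln)

text \<open>Inside the interval both logarithms are negative, so their product is positive. The sign
  is what later permits splitting the series.\<close>

lemma rogers_dilog_nonneg:
  assumes "z \<in> {0..1}"
  shows "0 \<le> rogers_dilog z"
proof -
  have "summable (\<lambda>n. z ^ Suc n / (real (Suc n))\<^sup>2)"
  proof (rule summable_comparison_test')
    show "summable (\<lambda>n. 1 / (real (Suc n))\<^sup>2)"
      using inverse_squares_sums by (simp add: sums_iff add.commute)
    show "norm (z ^ Suc n / (real (Suc n))\<^sup>2) \<le> 1 / (real (Suc n))\<^sup>2" for n
      using assms power_le_one[of z "Suc n"]
      by (auto simp: divide_right_mono simp del: power_Suc of_nat_Suc)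
  qed
  then have "0 \<le> Li2 z"
    unfolding Li2_def using assms by (intro suminf_nonneg) auto
  moreover have "0 \<le> ln z * ln (1 - z)"
    using assms by (cases "z = 0 \<or> z = 1") (auto intro: mult_nonpos_nonpos)
  ultimately show ?thesis
    using rogers_dilog_eq[OF assms] by simp
qed

text \<open>The derivative of the dilogarithm of \<open>f\<close> in terms of the logarithmic derivatives
  \<open>\<alpha>\<close> of \<open>f\<close> and \<open>- \<beta>\<close> of \<open>1 - f\<close>. In this form functional equations reduce to
  identities that are bilinear in logarithms and logarithmic derivatives.\<close>

lemma rogers_dilog_comp_has_field_derivative:
  assumes f: "(f has_field_derivative f') (at x)"
    and "0 < f x" "f x < 1" and \<alpha>: "f' = f x * \<alpha>" and \<beta>: "f' = (1 - f x) * \<beta>"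
  shows "((\<lambda>x. rogers_dilog (f x)) has_field_derivative
    (1 / 2 * (- ln (1 - f x) * \<alpha> - ln (f x) * \<beta>))) (at x)"
proof -
  define y where "y = f x"
  have y: "0 < y" "y < 1" using assms by (auto simp: y_def)
  have "((\<lambda>z. Li2 z + 1 / 2 * (ln z * ln (1 - z))) has_field_derivative
    (1 / 2 * (- ln (1 - y) / y - ln y / (1 - y)))) (at y)"
    using y by (auto intro!: derivative_eq_intros Li2_has_field_derivative simp: field_simps)
  then have "(rogers_dilog has_field_derivative
    (1 / 2 * (- ln (1 - y) / y - ln y / (1 - y)))) (at y)"
  proof (rule DERIV_cong_ev[THEN iffD1, rotated -1])
    \<comment> \<open>Agreement with the formula is known only on the unit interval; its interior is
      a neighbourhood of \<open>y\<close>, which suffices for the derivative.\<close>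
    have "eventually (\<lambda>z. z \<in> {0<..<1}) (nhds y)"
      using y by (intro eventually_nhds_in_open) auto
    then show "eventually (\<lambda>z. Li2 z + 1 / 2 * (ln z * ln (1 - z)) = rogers_dilog z) (nhds y)"
      by eventually_elim (simp add: rogers_dilog_eq)
  qed auto
  from DERIV_chain2[OF this[unfolded y_def] f]
  have "((\<lambda>x. rogers_dilog (f x)) has_field_derivative
    (1 / 2 * (- ln (1 - y) / y - ln y / (1 - y)) * f')) (at x)"
    by (simp add: y_def)
  moreover have "f' / y = \<alpha>"
    using y \<alpha> by (simp add: y_def[symmetric])
  moreover have "f' / (1 - y) = \<beta>"
    using y \<beta> by (simp add: y_def[symmetric])
  ultimately show ?thesis
    unfolding y_def by (elim DERIV_cong) (auto simp: field_simps)
qed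

section \<open>Functional equations: reflection and the telescoping relation\<close>

text \<open>The two derivatives cancel on the open interval, where the logarithms are regular;
  continuity carries constancy to the endpoints, and the value is read off at 0.\<close>

lemma rogers_dilog_reflection:
  assumes "x \<in> {0..1}"
  shows "rogers_dilog x + rogers_dilog (1 - x) = pi\<^sup>2 / 6"
proof -
  have "rogers_dilog x + rogers_dilog (1 - x) = rogers_dilog 0 + rogers_dilog (1 - 0)"
  proof (rule DERIV_isconst2[where b = 1 and f = "\<lambda>x. rogers_dilog x + rogers_dilog (1 - x)"])
    show "continuous_on {0..1} (\<lambda>x. rogers_dilog x + rogers_dilog (1 - x))"
      by (intro continuous_intros continuous_on_rogers_dilog
          continuous_on_compose2[OF continuous_on_rogers_dilog]) auto
    fix y :: real assume y: "0 < y" "y < 1"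
    have "((\<lambda>x. rogers_dilog x) has_field_derivative
        (1 / 2 * (- ln (1 - y) * (1 / y) - ln y * (1 / (1 - y))))) (at y)"
      using y by (intro rogers_dilog_comp_has_field_derivative[where f = "\<lambda>x. x" and f' = 1]) auto
    moreover have "((\<lambda>x. rogers_dilog (1 - x)) has_field_derivative
        (1 / 2 * (- ln (1 - (1 - y)) * (- 1 / (1 - y)) - ln (1 - y) * (- 1 / y)))) (at y)"
      using y by (intro rogers_dilog_comp_has_field_derivative[where f = "\<lambda>x. 1 - x" and f' = "- 1"])
        (auto intro!: derivative_eq_intros)
    ultimately have "((\<lambda>x. rogers_dilog x + rogers_dilog (1 - x)) has_field_derivative
        (1 / 2 * (- ln (1 - y) * (1 / y) - ln y * (1 / (1 - y))) +
         1 / 2 * (- ln (1 - (1 - y)) * (- 1 / (1 - y)) - ln (1 - y) * (- 1 / y)))) (at y)"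
      by (rule DERIV_add)
    then show "((\<lambda>x. rogers_dilog x + rogers_dilog (1 - x)) has_field_derivative 0) (at y)"
      by (rule DERIV_cong) (simp add: diff_divide_distrib add_divide_distrib)
  qed (use assms in auto)
  then show ?thesis by (simp add: rogers_dilog_def)
qed

text \<open>This potential comes from the five-term relation with \<open>x y = (1 - z) / (1 - p z)\<close> and
  \<open>x = (1 - p z) / (1 - p\<^sup>2 z)\<close>, with one of its terms rewritten by reflection.\<close>

definition rogers_telescope :: "real \<Rightarrow> real \<Rightarrow> real" where
  "rogers_telescope p z = rogers_dilog ((1 - z) / (1 - p * z)) + rogers_dilog (p * ((1 - z) / (1 - p * z)))"

text \<open>For \<open>a = (1 - z) / (1 - p * z)\<close>, the numbers \<open>a\<close>,
  \<open>p * a\<close> and their complements to 1 factor into \<open>p\<close>,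
  \<open>1 - p\<close>, \<open>z\<close>, \<open>1 - z\<close> and \<open>1 - p * z\<close>, so
  every logarithm splits.\<close>

lemma rogers_telescope_has_field_derivative:
  assumes "0 < p" "p < 1" "0 < z" "z < 1"
  shows "(rogers_telescope p has_field_derivative
    1 / 2 * ((2 * ln (1 - p) + ln z - 2 * ln (1 - p * z)) * (1 / (1 - z) - p / (1 - p * z))
        + (ln (1 - z) - ln (1 - p * z)) * (1 / z + p / (1 - p * z))
        + (ln p + ln (1 - z) - ln (1 - p * z)) * (p / (1 - p * z)))) (at z)"
proof -
  define a where "a = (\<lambda>z. (1 - z) / (1 - p * z))"
  define D where "D = - (1 - p) / (1 - p * z)\<^sup>2"
  have pz: "0 < 1 - p * z" "0 < 1 - z"
    using assms mult_strict_mono[of p 1 z 1] by auto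
  have da: "(a has_field_derivative D) (at z)"
    using pz unfolding a_def D_def
    by (auto intro!: derivative_eq_intros simp: divide_simps power2_eq_square) (simp add: algebra_simps)
  have 1: "1 - a z = (1 - p) * z / (1 - p * z)" "1 - p * a z = (1 - p) / (1 - p * z)"
    using pz by (simp_all add: a_def field_simps)
  have a: "0 < a z" "0 < 1 - a z" "0 < 1 - p * a z"
    unfolding 1 using assms pz by (simp_all add: a_def)
  have ln_a: "ln (a z) = ln (1 - z) - ln (1 - p * z)"
      "ln (p * a z) = ln p + ln (1 - z) - ln (1 - p * z)"
      "ln (1 - a z) = ln (1 - p) + ln z - ln (1 - p * z)"
      "ln (1 - p * a z) = ln (1 - p) - ln (1 - p * z)"
    unfolding 1 using assms pz by (simp_all add: a_def ln_div ln_mult)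
  define \<alpha> where "\<alpha> = p / (1 - p * z) - 1 / (1 - z)"
  have \<alpha>: "D = a z * \<alpha>"
    using pz by (simp add: \<alpha>_def a_def D_def divide_simps) (simp add: power2_eq_square algebra_simps)
  have \<beta>: "D = (1 - a z) * (- (1 / z + p / (1 - p * z)))" "p * D = (1 - p * a z) * (- (p / (1 - p * z)))"
    unfolding 1 using assms pz
    by (simp_all add: D_def divide_simps) (simp_all add: power2_eq_square algebra_simps)
  have "((\<lambda>z. rogers_dilog (a z)) has_field_derivative
      1 / 2 * (- ln (1 - a z) * \<alpha> - ln (a z) * (- (1 / z + p / (1 - p * z))))) (at z)"
    using a \<alpha> \<beta> by (intro rogers_dilog_comp_has_field_derivative[OF da]) auto
  moreover have "((\<lambda>z. rogers_dilog (p * a z)) has_field_derivative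
      1 / 2 * (- ln (1 - p * a z) * \<alpha> - ln (p * a z) * (- (p / (1 - p * z))))) (at z)"
    using a \<alpha> \<beta> assms
    by (intro rogers_dilog_comp_has_field_derivative[OF DERIV_cmult[OF da]]) auto
  ultimately have "((\<lambda>z. rogers_dilog (a z) + rogers_dilog (p * a z)) has_field_derivative
      1 / 2 * (- ln (1 - a z) * \<alpha> - ln (a z) * (- (1 / z + p / (1 - p * z)))) +
      1 / 2 * (- ln (1 - p * a z) * \<alpha> - ln (p * a z) * (- (p / (1 - p * z))))) (at z)"
    by (rule DERIV_add)
  moreover have "rogers_telescope p = (\<lambda>z. rogers_dilog (a z) + rogers_dilog (p * a z))"
    by (simp add: rogers_telescope_def[abs_def] a_def)
  \<comment> \<open>With the rational factors as atoms, the remaining identity is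
    polynomial.\<close>
  moreover define P Q Z where "P = p / (1 - p * z)" and "Q = 1 / (1 - z)" and "Z = 1 / z"
  ultimately show ?thesis
    unfolding ln_a \<alpha>_def P_def[symmetric] Q_def[symmetric] Z_def[symmetric]
    by (auto elim!: DERIV_cong simp: field_simps)
qed

lemma continuous_on_rogers_telescope:
  assumes "0 < p" "p < 1"
  shows "continuous_on {0..1} (rogers_telescope p)"
proof -
  have pz: "0 < 1 - p * z \<and> 1 - z \<le> 1 - p * z" if "0 \<le> z" "z \<le> 1" for z
    using assms that mult_left_le_one_le[of z p] mult_left_le[of z p] by linarith
  have a: "0 \<le> (1 - z) / (1 - p * z)" "(1 - z) / (1 - p * z) \<le> 1" if "z \<in> {0..1}" for z
    using that pz[of z] by auto
  have b: "0 \<le> p * ((1 - z) / (1 - p * z))" "p * ((1 - z) / (1 - p * z)) \<le> 1" if "z \<in> {0..1}" for z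
    using a[OF that] assms by (intro mult_nonneg_nonneg mult_le_one; simp)+
  have c: "continuous_on {0..1} (\<lambda>z. (1 - z) / (1 - p * z))"
    using pz by (intro continuous_intros) force
  have "(\<lambda>z. (1 - z) / (1 - p * z)) ` {0..1} \<subseteq> {0..1}"
    using a by (intro image_subsetI) simp
  moreover have "(\<lambda>z. p * ((1 - z) / (1 - p * z))) ` {0..1} \<subseteq> {0..1}"
    using b by (intro image_subsetI) simp
  ultimately show ?thesis
    unfolding rogers_telescope_def[abs_def]
    using continuous_on_compose2[OF continuous_on_rogers_dilog c]
      continuous_on_compose2[OF continuous_on_rogers_dilog continuous_on_mult_left[OF c]]
    by (intro continuous_on_add) blast+
qed

text \<open>All arguments and their complements factor into \<open>p\<close>, \<open>1 - p\<close>,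
  \<open>z\<close>, \<open>1 - z\<close>, \<open>1 - p * z\<close> and
  \<open>1 - p * (p * z)\<close>, so the derivative of the difference expands into products of
  logarithms and logarithmic derivatives that cancel.\<close>

lemma rogers_dilog_telescope:
  assumes "0 < p" "p < 1" "0 < z" "z < 1"
  shows "rogers_dilog (z * (1 - p)\<^sup>2 / (1 - p * z)\<^sup>2) = rogers_telescope p (p * z) - rogers_telescope p z"
proof -
  define f where "f = (\<lambda>z. z * (1 - p)\<^sup>2 / (1 - p * z)\<^sup>2)"
  define E where "E = (\<lambda>z. rogers_dilog (f z) - rogers_telescope p (p * z) + rogers_telescope p z)"
  have pos: "0 < 1 - p * z" "0 \<le> 1 - p * (p * z)" "p * z \<le> 1" if "0 \<le> z" "z \<le> 1" for z
  proof -
    have "0 \<le> p * z" "p * z \<le> p" using assms that by (simp_all add: mult_left_le)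
    moreover from this have "p * (p * z) \<le> p" using assms by (intro mult_left_le) linarith+
    ultimately show "0 < 1 - p * z" "0 \<le> 1 - p * (p * z)" "p * z \<le> 1"
      using assms by linarith+
  qed
  have 1: "1 - f z = (1 - z) * (1 - p * (p * z)) / (1 - p * z)\<^sup>2" if "0 \<le> z" "z \<le> 1" for z
    using pos[of z] that unfolding f_def
    by (simp add: divide_simps) (simp add: power2_eq_square algebra_simps)
  have f01: "f z \<in> {0..1}" if "0 \<le> z" "z \<le> 1" for z
  proof -
    have "0 \<le> 1 - f z" unfolding 1[OF that] using that pos[of z] by simp
    moreover have "0 \<le> f z" using that by (simp add: f_def)
    ultimately show ?thesis by simp
  qed
  have "E z = E 0"
  proof (rule DERIV_isconst2[where b = 1 and f = E])
    have "continuous_on {0..1} f"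
      unfolding f_def using pos(1) by (intro continuous_intros) force
    then show "continuous_on {0..1} E"
      unfolding E_def using f01 pos(3) assms
      by (intro continuous_intros continuous_on_compose2[OF continuous_on_rogers_dilog]
        continuous_on_compose2[OF continuous_on_rogers_telescope] continuous_on_rogers_telescope) auto
    fix x :: real assume x: "0 < x" "x < 1"
    have px: "0 < 1 - p * x" "0 < 1 - x" "0 < 1 - p * (p * x)" "0 < p * x"
      using x assms mult_strict_mono[of p 1 x 1] mult_strict_mono[of p 1 "p * x" 1] by auto
    have fx: "0 < f x" "0 < 1 - f x"
      using px x assms by (simp_all add: 1) (simp add: f_def)
    have ln_f: "ln (f x) = ln x + 2 * ln (1 - p) - 2 * ln (1 - p * x)"
        "ln (1 - f x) = ln (1 - x) + ln (1 - p * (p * x)) - 2 * ln (1 - p * x)"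
      using x px assms by (simp_all add: 1) (simp_all add: f_def ln_div ln_mult ln_realpow)
    define \<alpha> where "\<alpha> = 1 / x + 2 * (p / (1 - p * x))"
    define \<beta> where "\<beta> = 1 / (1 - x) + p * (p / (1 - p * (p * x))) - 2 * (p / (1 - p * x))"
    define w v where "w = 1 - p * x" and "v = 1 - p * (p * x)"
    have wv: "0 < w" "0 < v" using px by (simp_all add: w_def v_def)
    have df: "(f has_field_derivative f x * \<alpha>) (at x)"
    proof -
      have "(f has_field_derivative
          ((1 - p)\<^sup>2 * w\<^sup>2 - x * (1 - p)\<^sup>2 * (2 * w * (- p))) / (w\<^sup>2 * w\<^sup>2)) (at x)"
        unfolding f_def w_def using px by (auto intro!: derivative_eq_intros)
      moreover have "((1 - p)\<^sup>2 * w\<^sup>2 - x * (1 - p)\<^sup>2 * (2 * w * (- p))) / (w\<^sup>2 * w\<^sup>2) = f x * \<alpha>"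
        unfolding f_def \<alpha>_def w_def[symmetric] using wv x
        by (simp add: field_simps power2_eq_square)
      ultimately show ?thesis by simp
    qed
    have \<beta>: "f x * \<alpha> = (1 - f x) * \<beta>"
    proof -
      have "f x * \<alpha> = (1 - p)\<^sup>2 * (w + 2 * p * x) / w ^ 3"
        unfolding f_def \<alpha>_def w_def[symmetric] using wv x
        by (simp add: field_simps power2_eq_square power3_eq_cube)
      \<comment> \<open>The right-hand side is the numerator of \<open>\<beta>\<close> over the
        common denominator \<open>(1 - x) * v * w\<close>.\<close>
      also have "(1 - p)\<^sup>2 * (w + 2 * p * x) = (v + p\<^sup>2 * (1 - x)) * w - 2 * p * (1 - x) * v"
        by (simp add: w_def v_def power2_eq_square algebra_simps)
      also have "\<dots> / w ^ 3 = (1 - x) * v / w\<^sup>2 * (1 / (1 - x) + p * (p / v) - 2 * (p / w))"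
      proof -
        define s where "s = 1 - x"
        have "s > 0" using x by (simp add: s_def)
        then show ?thesis unfolding s_def[symmetric] using wv
          by (simp add: field_simps power2_eq_square power3_eq_cube)
      qed
      also have "\<dots> = (1 - f x) * \<beta>"
        using x by (simp add: 1 \<beta>_def w_def v_def)
      finally show ?thesis .
    qed
    have 2: "((\<lambda>x. rogers_dilog (f x)) has_field_derivative
        1 / 2 * (- ln (1 - f x) * \<alpha> - ln (f x) * \<beta>)) (at x)"
      using fx by (intro rogers_dilog_comp_has_field_derivative[OF df]) (auto simp: \<beta>)
    have 3: "((\<lambda>x. rogers_telescope p (p * x)) has_field_derivative
        1 / 2 * ((2 * ln (1 - p) + ln (p * x) - 2 * ln (1 - p * (p * x))) * (1 / (1 - p * x) - p / (1 - p * (p * x)))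
        + (ln (1 - p * x) - ln (1 - p * (p * x))) * (1 / (p * x) + p / (1 - p * (p * x)))
        + (ln p + ln (1 - p * x) - ln (1 - p * (p * x))) * (p / (1 - p * (p * x)))) * (p * 1)) (at x)"
      using px x assms
      by (intro DERIV_chain2[OF rogers_telescope_has_field_derivative] DERIV_cmult DERIV_ident) auto
    define P Q R X where "P = p / (1 - p * x)" and "Q = 1 / (1 - x)"
      and "R = p * (p / (1 - p * (p * x)))" and "X = 1 / x"
    \<comment> \<open>The chain-rule factor \<open>p\<close> turns the rational factors at
      \<open>p * x\<close> into the atoms used by the other two terms.\<close>
    have "1 / 2 * (A * (1 / (1 - p * x) - p / (1 - p * (p * x)))
        + B * (1 / (p * x) + p / (1 - p * (p * x))) + C * (p / (1 - p * (p * x)))) * (p * 1)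
        = 1 / 2 * (A * (P - R) + B * (X + R) + C * R)" for A B C
    proof -
      have "P = 1 / (1 - p * x) * p" "X = 1 / (p * x) * p"
        using assms by (auto simp: P_def X_def)
      then show ?thesis by (simp only: R_def) (simp add: algebra_simps)
    qed
    note 4 = 3[unfolded this]
    have 5: "ln (p * x) = ln p + ln x"
      using x assms by (simp add: ln_mult)
    show "(E has_field_derivative 0) (at x)"
      unfolding E_def
      by (rule DERIV_cong[OF DERIV_add[OF DERIV_diff[OF 2 4] rogers_telescope_has_field_derivative[OF assms(1,2) x]]],
        unfold ln_f 5 \<alpha>_def \<beta>_def P_def[symmetric] Q_def[symmetric] R_def[symmetric] X_def[symmetric])
       (simp add: field_simps)
  qed (use assms in auto)
  moreover have "E 0 = 0"
    by (simp add: E_def f_def rogers_dilog_def)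
  ultimately show ?thesis
    by (simp add: E_def f_def)
qed

text \<open>The telescoping relation is applied at \<open>z = p ^ Suc n\<close>, so index
  \<open>n\<close> carries a_m with \<open>m = n + 2\<close>.\<close>

lemma rogers_dilog_geometric_sums:
  assumes "0 < p" "p < 1"
  shows "(\<lambda>n. rogers_dilog (p ^ Suc n * (1 - p)\<^sup>2 / (1 - p ^ Suc (Suc n))\<^sup>2)) sums rogers_dilog p"
proof -
  have pn: "p ^ Suc n \<in> {0<..<1}" for n
    using assms power_Suc_less_one[of p n] by auto
  have "(\<lambda>n. rogers_telescope p (p ^ Suc n)) \<longlonglongrightarrow> rogers_telescope p 0"
  proof (rule continuous_on_tendsto_compose[OF continuous_on_rogers_telescope[OF assms]])
    show "(\<lambda>n. p ^ Suc n) \<longlonglongrightarrow> 0"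
      using assms by (intro LIMSEQ_power_zero[THEN LIMSEQ_Suc]) auto
    show "\<forall>\<^sub>F n in sequentially. p ^ Suc n \<in> {0..1}"
      using pn by (intro always_eventually) (auto intro: less_imp_le)
  qed auto
  then have "(\<lambda>n. rogers_telescope p (p ^ Suc (Suc n)) - rogers_telescope p (p ^ Suc n)) sums
      (rogers_telescope p 0 - rogers_telescope p (p ^ Suc 0))"
    by (rule telescope_sums)
  moreover have "rogers_telescope p (p ^ Suc (Suc n)) - rogers_telescope p (p ^ Suc n)
      = rogers_dilog (p ^ Suc n * (1 - p)\<^sup>2 / (1 - p ^ Suc (Suc n))\<^sup>2)" for n
    using rogers_dilog_telescope[of p "p ^ Suc n"] assms pn[of n] by simp
  \<comment> \<open>At 0 the potential is L(1) + L(p); at \<open>p\<close> it is L(1/(1+p)) +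
    L(p/(1+p)), which is L(1) by reflection.\<close>
  moreover have "rogers_telescope p 0 - rogers_telescope p (p ^ Suc 0) = rogers_dilog p"
  proof -
    have *: "(1 - p) / (1 - p * p) = 1 / (1 + p)"
      using assms mult_strict_mono[of p 1 p 1] by (simp add: divide_simps) (simp add: algebra_simps)
    moreover have "p * (1 / (1 + p)) = 1 - 1 / (1 + p)"
      using assms by (simp add: divide_simps)
    ultimately have "rogers_telescope p p = pi\<^sup>2 / 6"
      using rogers_dilog_reflection[of "1 / (1 + p)"] assms by (simp add: rogers_telescope_def)
    then show ?thesis
      by (simp add: rogers_telescope_def rogers_dilog_def)
  qed
  ultimately show ?thesis by simp
qed

section \<open>Splitting of series, Binet formulas and linear recurrences\<close>

text \<open>Subseries of a convergent nonnegative series converge, and summing in consecutive pairs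
  keeps the total.\<close>

lemma
  fixes f :: "nat \<Rightarrow> real"
  assumes "summable f" "\<And>n. 0 \<le> f n"
  shows summable_even_terms: "summable (\<lambda>n. f (2 * n))"
    and summable_odd_terms: "summable (\<lambda>n. f (2 * n + 1))"
    and suminf_even_odd_terms: "suminf f = (\<Sum>n. f (2 * n)) + (\<Sum>n. f (2 * n + 1))"
proof -
  show e: "summable (\<lambda>n. f (2 * n))"
    using summable_reindex[OF assms(1) _ assms(2), of "\<lambda>n. 2 * n"] by (simp add: inj_on_def o_def)
  show o: "summable (\<lambda>n. f (2 * n + 1))"
    using summable_reindex[OF assms(1) _ assms(2), of "\<lambda>n. 2 * n + 1"] by (simp add: inj_on_def o_def)
  have "(\<lambda>n. sum f {n * 2..<n * 2 + 2}) sums suminf f"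
    by (rule sums_group) (use assms in \<open>auto simp: summable_sums\<close>)
  moreover have "sum f {n * 2..<n * 2 + 2} = f (2 * n) + f (2 * n + 1)" for n
    by (simp add: numeral_2_eq_2 mult.commute)
  ultimately have "(\<lambda>n. f (2 * n) + f (2 * n + 1)) sums suminf f"
    by simp
  then show "suminf f = (\<Sum>n. f (2 * n)) + (\<Sum>n. f (2 * n + 1))"
    unfolding suminf_add[OF e o] by (rule sums_unique)
qed

text \<open>Both bases are roots of x^2 = x + 1, so their powers obey the Lucas recurrence.\<close>

lemma lucas_closed_form: "real (lucas n) = ((1 + sqrt 5) / 2) ^ n + ((1 - sqrt 5) / 2) ^ n"
proof (induction n rule: lucas.induct)
  case (3 n)
  have "x ^ Suc (Suc n) = x ^ Suc n + x ^ n" if "x\<^sup>2 = x + 1" for x :: real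
  proof -
    have "x ^ Suc (Suc n) = x\<^sup>2 * x ^ n" by (simp add: power2_eq_square)
    also have "\<dots> = x ^ Suc n + x ^ n" unfolding that by (simp add: algebra_simps)
    finally show ?thesis .
  qed
  note recurrence = this
  have "((1 + sqrt 5) / 2)\<^sup>2 = (1 + sqrt 5) / 2 + 1" "((1 - sqrt 5) / 2)\<^sup>2 = (1 - sqrt 5) / 2 + 1"
    by (simp_all add: power2_eq_square field_simps)
  note this[THEN recurrence]
  then show ?case using 3 by (simp del: power_Suc)
qed (simp_all add: field_simps)

text \<open>The conjugate of the golden ratio is minus its reciprocal, so its \<open>m\<close>-th
  power is \<open>- p\<close> for odd \<open>m\<close>; Binet's formulas then involve
  \<open>p\<close> alone.\<close>

lemma
  fixes p :: real
  assumes "odd m" and p: "p = 1 / ((1 + sqrt 5) / 2) ^ m"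
  shows lucas_mult_odd: "real (lucas (n * m)) = 1 / p ^ n + (- p) ^ n"
    and fib_mult_odd: "sqrt 5 * real (fib (n * m)) = 1 / p ^ n - (- p) ^ n"
proof -
  have sqrt_pos: "0 < 1 + sqrt (5::real)"
    by (simp add: add_pos_pos)
  have "(1 - sqrt 5) / 2 = - (1 / ((1 + sqrt 5) / 2))"
    using sqrt_pos by (simp add: divide_simps) (simp add: algebra_simps)
  then have \<psi>: "((1 - sqrt 5) / 2) ^ m = - p"
    using assms(1) unfolding p by (simp only: power_minus_odd power_one_over simp_thms)
  have \<phi>: "((1 + sqrt 5) / 2) ^ m = 1 / p"
    unfolding p by simp
  show "real (lucas (n * m)) = 1 / p ^ n + (- p) ^ n"
    unfolding lucas_closed_form mult.commute[of n m] power_mult \<phi> \<psi> by (simp add: power_divide)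
  show "sqrt 5 * real (fib (n * m)) = 1 / p ^ n - (- p) ^ n"
    unfolding fib_closed_form mult.commute[of n m] power_mult \<phi> \<psi> by (simp add: power_divide)
qed

text \<open>The characteristic roots are \<open>p\<close> and \<open>1 / p\<close>; the single
  fraction with free \<open>c\<close> and \<open>d\<close> serves both sequences of the
  theorem.\<close>

lemma linear_recurrence_closed_form:
  fixes p c d :: real and a :: "nat \<Rightarrow> real"
  assumes "p \<noteq> 0" "d \<noteq> 0" "a 0 = (1 - c) / d" "a 1 = (1 - c * p\<^sup>2) / (p * d)"
    and "\<And>n. a (Suc (Suc n)) = (1 / p + p) * a (Suc n) - a n"
  shows "a n = (1 - c * p ^ (2 * n)) / (p ^ n * d)"
\<comment> \<open>\<open>fib.induct\<close> is used only for its shape: two base cases and a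
  two-step induction.\<close>
proof (induction n rule: fib.induct)
  case (3 n)
  \<comment> \<open>Here \<open>e\<close> stands for \<open>p ^ n\<close> and \<open>b\<close> for
    \<open>c * p ^ (2 * n)\<close>.\<close>
  have *: "(1 / p + p) * ((1 - b * p\<^sup>2) / (e * p * d)) - (1 - b) / (e * d) = (1 - b * p\<^sup>2 * p\<^sup>2) / (e * p * p * d)"
    if "e \<noteq> 0" for b e
    using assms(1,2) that by (simp add: divide_simps) (simp add: power2_eq_square algebra_simps)
  have "p ^ (2 * Suc n) = p ^ (2 * n) * p\<^sup>2" "p ^ (2 * Suc (Suc n)) = p ^ (2 * n) * p\<^sup>2 * p\<^sup>2"
    by (simp_all add: power2_eq_square)
  moreover have "p ^ Suc n = p ^ n * p" "p ^ Suc (Suc n) = p ^ n * p * p"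
    by simp_all
  ultimately show ?case
    using *[of "p ^ n" "c * p ^ (2 * n)"] assms(1) unfolding assms(5) 3 by (simp only: mult.assoc) simp
qed (use assms in simp_all)

section \<open>The series identities for odd powers of the golden ratio\<close>

theorem mainTheorem8:
  fixes k k0 :: nat and \<phi> u t t0 :: real and H K :: "nat \<Rightarrow> real"
  assumes "k0 = 2 * k + 1"
    and "\<phi> = (1 + sqrt 5) / 2"
    and "u = \<phi> powr (real (2 * k + 1) / 2)"
    and "t = u + 1 / u"
    and "t0 = t\<^sup>2 - 2"
    and "H 1 = 1" and "H 2 = t0"
    and "\<And>n. n \<ge> 3 \<Longrightarrow> H n = t0 * H (n - 1) - H (n - 2)"
    and "K 0 = 1" and "K 1 = t0 + 1"
    and "\<And>n. n \<ge> 2 \<Longrightarrow> K n = t0 * K (n - 1) - K (n - 2)"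
  shows "t0 = real (fib (2 * k + 1)) * sqrt 5 \<and>
    (let
       A = (\<lambda>n. rogers_dilog (1 / (t\<^sup>2 * (H n)\<^sup>2)));
       B = (\<lambda>n. rogers_dilog (1 / (K n)\<^sup>2));
       A1 = (\<lambda>n. rogers_dilog
               ((real (lucas k0) / (t * real (lucas ((2 * n - 1) * k0))))\<^sup>2));
       A2 = (\<lambda>n. rogers_dilog
               ((real (lucas k0) / (sqrt 5 * t * real (fib (2 * n * k0))))\<^sup>2));
       B1 = (\<lambda>n. rogers_dilog
               ((real (lucas k0) /
                 (real (lucas ((2 * n - 1) * k0)) + sqrt 5 * real (fib (2 * n * k0))))\<^sup>2));
       B2 = (\<lambda>n. rogers_dilog
               ((real (lucas k0) /
                 (real (lucas ((2 * n - 1) * k0)) + sqrt 5 * real (fib (2 * (n - 1) * k0))))\<^sup>2))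
     in
       summable (\<lambda>n. A (n + 1)) \<and> summable (\<lambda>n. B (n + 1)) \<and>
       summable (\<lambda>n. A1 (n + 1)) \<and> summable (\<lambda>n. A2 (n + 1)) \<and>
       summable (\<lambda>n. B1 (n + 1)) \<and> summable (\<lambda>n. B2 (n + 2)) \<and>
       rogers_dilog (1 / \<phi> ^ (2 * k + 1)) = (\<Sum>n. A (n + 1)) + (\<Sum>n. B (n + 1)) \<and>
       (\<Sum>n. A (n + 1)) = (\<Sum>n. A1 (n + 1)) + (\<Sum>n. A2 (n + 1)) \<and>
       (\<Sum>n. B (n + 1)) = (\<Sum>n. B1 (n + 1)) + (\<Sum>n. B2 (n + 2)))"
proof -
  \<comment> \<open>Everything becomes rational in \<open>p\<close>: the half-integral power
    \<open>u\<close> enters only through its square \<open>1 / p\<close>.\<close>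
  define p where "p = 1 / \<phi> ^ k0"
  have \<phi>: "\<phi> > 1"
    using real_less_rsqrt[of 1 5] by (simp add: assms(2))
  have p: "0 < p" "p < 1"
    using \<phi> one_less_power[of \<phi> k0] assms(1) by (simp_all add: p_def)
  have "u\<^sup>2 = \<phi> powr real k0"
    using \<phi> by (simp add: assms(1,3) power2_eq_square flip: powr_add)
  then have u2: "u\<^sup>2 = 1 / p"
    using \<phi> by (simp add: p_def powr_realpow)
  have u: "u > 0" using \<phi> by (simp add: assms(3))
  have t2: "t\<^sup>2 = (1 + p)\<^sup>2 / p"
  proof -
    have "t\<^sup>2 = u\<^sup>2 + 1 / u\<^sup>2 + 2"
      using u by (simp add: assms(4) power2_eq_square field_simps)
    also have "\<dots> = (1 + p)\<^sup>2 / p"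
      unfolding u2 using p by (simp add: power2_eq_square field_simps)
    finally show ?thesis .
  qed
  have t0: "t0 = 1 / p + p"
    unfolding assms(5) t2 using p by (simp add: power2_eq_square field_simps)
  have p': "p = 1 / ((1 + sqrt 5) / 2) ^ k0" "odd k0"
    unfolding p_def assms(1,2) by simp_all
  note lucas = lucas_mult_odd[OF p'(2,1)] and fib = fib_mult_odd[OF p'(2,1)]
  have pn: "0 < p ^ n" "n > 0 \<Longrightarrow> p ^ n < 1" for n
    using p by (auto simp: power_less_one_iff)
  \<comment> \<open>This is Binet's formula for \<open>k0\<close> itself, where oddness turns the
    difference into \<open>1 / p + p\<close>.\<close>
  have goal1: "t0 = real (fib (2 * k + 1)) * sqrt 5"
    using fib[of 1] by (simp add: t0 assms(1) mult.commute)

  \<comment> \<open>The index is shifted because the recurrence starts at \<open>H 1\<close>;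
    \<open>H 0\<close> is unconstrained.\<close>
  have H: "H (Suc n) = (1 - p\<^sup>2 * p ^ (2 * n)) / (p ^ n * (1 - p\<^sup>2))" for n
  proof (rule linear_recurrence_closed_form[where a = "\<lambda>n. H (Suc n)"])
    have "t0 = (1 + p\<^sup>2) * (1 - p\<^sup>2) / (p * (1 - p\<^sup>2))"
      using p pn(2)[of 2] by (simp add: t0 field_simps power2_eq_square)
    then show "H (Suc 1) = (1 - p\<^sup>2 * p\<^sup>2) / (p * (1 - p\<^sup>2))"
      using assms(7) by (simp add: numeral_2_eq_2 algebra_simps)
    show "H (Suc (Suc (Suc n))) = (1 / p + p) * H (Suc (Suc n)) - H (Suc n)" for n
      using assms(8)[of "Suc (Suc (Suc n))"] by (simp add: t0)
  qed (use assms(6) p pn(2)[of 2] in simp_all)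
  have K: "K n = (1 - p * p ^ (2 * n)) / (p ^ n * (1 - p))" for n
  proof (rule linear_recurrence_closed_form)
    have "1 / p + p + 1 = (1 + p + p\<^sup>2) * (1 - p) / (p * (1 - p))"
      using p by (simp add: field_simps power2_eq_square)
    also have "(1 + p + p\<^sup>2) * (1 - p) = 1 - p * p\<^sup>2"
      by (simp add: algebra_simps power2_eq_square)
    finally show "K 1 = (1 - p * p\<^sup>2) / (p * (1 - p))"
      using assms(10) by (simp only: t0)
    show "K (Suc (Suc n)) = (1 / p + p) * K (Suc n) - K n" for n
      using assms(11)[of "Suc (Suc n)"] by (simp add: t0)
  qed (use assms(9) p in simp_all)

  \<comment> \<open>\<open>S n\<close> is L(a_m) with \<open>m = n + 2\<close>; the shift preserves
    parity and leaves out a_1 = 1.\<close>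
  define S where "S n = rogers_dilog (p ^ Suc n * (1 - p)\<^sup>2 / (1 - p ^ Suc (Suc n))\<^sup>2)" for n
  have S_sums: "S sums rogers_dilog p"
    unfolding S_def[abs_def] by (rule rogers_dilog_geometric_sums[OF p])
  have S_nonneg: "0 \<le> S n" for n
    unfolding S_def
  proof (intro rogers_dilog_nonneg)
    \<comment> \<open>Since \<open>p ^ Suc (Suc n) \<le> p\<close>, the denominator is at least
      \<open>(1 - p)\<^sup>2\<close>, which keeps the argument in the unit interval.\<close>
    have "p ^ Suc n * (1 - p)\<^sup>2 \<le> (1 - p ^ Suc (Suc n))\<^sup>2"
    proof -
      have le: "p ^ m \<le> 1" for m
        using p by (intro power_le_one) auto
      have "p ^ Suc (Suc n) \<le> p"
        using p le[of "Suc n"] mult_left_le[of "p ^ Suc n" p] by simp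
      note le[of "Suc n"] this
      then have "p ^ Suc n * (1 - p)\<^sup>2 \<le> 1 * (1 - p)\<^sup>2" "(1 - p)\<^sup>2 \<le> (1 - p ^ Suc (Suc n))\<^sup>2"
        using p by (auto intro!: mult_right_mono power_mono simp del: power_Suc)
      then show ?thesis by simp
    qed
    then show "p ^ Suc n * (1 - p)\<^sup>2 / (1 - p ^ Suc (Suc n))\<^sup>2 \<in> {0..1}"
      using p by (auto simp: divide_le_eq_1 simp del: power_Suc)
  qed

  have lucas_k0: "real (lucas k0) = (1 - p) * (1 + p) / p"
    using lucas[of 1] p by (simp add: field_simps)
  have lucas_odd: "real (lucas ((2 * n + 1) * k0)) = 1 / p ^ (2 * n + 1) - p ^ (2 * n + 1)" for n
    unfolding lucas by simp
  have fib_even: "sqrt 5 * real (fib (2 * n * k0)) = 1 / p ^ (2 * n) - p ^ (2 * n)" for n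
    unfolding fib by simp
  have t: "(x / (t * y))\<^sup>2 = x\<^sup>2 * p / ((1 + p)\<^sup>2 * y\<^sup>2)" for x y
    by (simp add: power_divide power_mult_distrib t2)
  \<comment> \<open>For \<open>e\<^sup>2 = p ^ m\<close> the right-hand side is a_m; the factor
    \<open>1 + p\<close> cancels against \<open>t\<close>.\<close>
  have product: "((1 - p) * (1 + p) / p / (t * (1 / e - e)))\<^sup>2 = e\<^sup>2 / p * (1 - p)\<^sup>2 / (1 - e\<^sup>2)\<^sup>2"
    if "0 < e" for e
  proof -
    have *: "1 / e - e = (1 - e\<^sup>2) / e"
      using that by (simp add: field_simps power2_eq_square)
    show ?thesis
      unfolding t * using p by (simp add: power_divide power_mult_distrib) (simp add: power2_eq_square)
  qed
  \<comment> \<open>For \<open>e\<^sup>2 = p ^ (m - 1)\<close> this is a_m: the adjacent powers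
    \<open>e\<close> and \<open>e * p\<close> together produce a factor \<open>1 + p\<close>, which
    cancels.\<close>
  have sum: "((1 - p) * (1 + p) / p / ((1 / e - e) + (1 / (e * p) - e * p)))\<^sup>2 = e\<^sup>2 * (1 - p)\<^sup>2 / (1 - e\<^sup>2 * p)\<^sup>2"
    if "0 < e" for e
  proof -
    have *: "(1 / e - e) + (1 / (e * p) - e * p) = (1 + p) * (1 - e\<^sup>2 * p) / (e * p)"
      using that p by (simp add: field_simps power2_eq_square)
    show ?thesis
      unfolding * using p by (simp add: power_divide power_mult_distrib)
  qed
  have pow: "(p ^ m)\<^sup>2 = p ^ (2 * m)" for m
    by (simp add: mult.commute flip: power_mult)

  have A: "rogers_dilog (1 / (t\<^sup>2 * (H (n + 1))\<^sup>2)) = S (2 * n)" for n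
  proof -
    have "1 - p\<^sup>2 = (1 - p) * (1 + p)"
      by (simp add: power2_eq_square algebra_simps)
    then have "1 / (t\<^sup>2 * (H (n + 1))\<^sup>2) = p * (p ^ n)\<^sup>2 * (1 - p)\<^sup>2 / (1 - p\<^sup>2 * p ^ (2 * n))\<^sup>2"
      using p by (simp add: t2 H power_divide power_mult_distrib)
    then show ?thesis
      by (simp add: S_def pow power2_eq_square[of p] mult.assoc)
  qed
  have B: "rogers_dilog (1 / (K (n + 1))\<^sup>2) = S (2 * n + 1)" for n
  proof -
    have "1 / (K (n + 1))\<^sup>2 = (p ^ (n + 1))\<^sup>2 * (1 - p)\<^sup>2 / (1 - p * p ^ (2 * (n + 1)))\<^sup>2"
      by (simp only: K power_divide power_mult_distrib) simp
    then show ?thesis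
      unfolding S_def pow by simp
  qed
  have A1: "rogers_dilog ((real (lucas k0) / (t * real (lucas ((2 * (n + 1) - 1) * k0))))\<^sup>2) = S (4 * n)" for n
  proof -
    have "(p ^ (2 * n + 1))\<^sup>2 = p ^ Suc (Suc (4 * n))"
      unfolding pow by simp
    then show ?thesis
      using product[of "p ^ (2 * n + 1)"] p pn(1) lucas_odd[of n]
      by (simp add: S_def lucas_k0)
  qed
  have A2: "rogers_dilog ((real (lucas k0) / (sqrt 5 * t * real (fib (2 * (n + 1) * k0))))\<^sup>2) = S (4 * n + 2)" for n
  proof -
    have "sqrt 5 * t * real (fib (2 * (n + 1) * k0)) = t * (1 / p ^ (2 * (n + 1)) - p ^ (2 * (n + 1)))"
      unfolding fib_even[symmetric] by (simp only: ac_simps)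
    moreover have "(p ^ (2 * (n + 1)))\<^sup>2 = p ^ Suc (Suc (4 * n + 2))"
      unfolding pow by simp
    moreover have "p ^ Suc (Suc (4 * n + 2)) / p = p ^ Suc (4 * n + 2)"
      using p by simp
    ultimately show ?thesis
      by (simp only: S_def lucas_k0 product[OF pn(1)])
  qed
  have B1: "rogers_dilog ((real (lucas k0) / (real (lucas ((2 * (n + 1) - 1) * k0)) +
      sqrt 5 * real (fib (2 * (n + 1) * k0))))\<^sup>2) = S (4 * n + 1)" for n
  proof -
    have i: "2 * (n + 1) - 1 = 2 * n + 1" by simp
    have e: "p ^ (2 * (n + 1)) = p ^ (2 * n + 1) * p" by simp
    have f: "(p ^ (2 * n + 1))\<^sup>2 = p ^ Suc (4 * n + 1)"
      unfolding pow by simp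
    show ?thesis
      unfolding i lucas_k0 lucas_odd fib_even e
      unfolding sum[OF pn(1)] f S_def by (simp add: mult.commute)
  qed
  \<comment> \<open>This series starts at index 2 because index 1 would give the argument a_1 =
    1.\<close>
  have B2: "rogers_dilog ((real (lucas k0) / (real (lucas ((2 * (n + 2) - 1) * k0)) +
      sqrt 5 * real (fib (2 * (n + 2 - 1) * k0))))\<^sup>2) = S (4 * n + 3)" for n
  proof -
    \<comment> \<open>Unlike in \<open>B1\<close>, the Fibonacci number has the smaller index, so
      the summands are swapped to fit \<open>sum\<close>.\<close>
    have i: "real (lucas ((2 * (n + 2) - 1) * k0)) + sqrt 5 * real (fib (2 * (n + 2 - 1) * k0))
        = sqrt 5 * real (fib (2 * (n + 1) * k0)) + real (lucas ((2 * (n + 1) + 1) * k0))"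
      by simp
    have e: "p ^ (2 * (n + 1) + 1) = p ^ (2 * (n + 1)) * p" by simp
    have "2 * (2 * (n + 1)) = Suc (4 * n + 3)" by simp
    then have f: "(p ^ (2 * (n + 1)))\<^sup>2 = p ^ Suc (4 * n + 3)"
      unfolding pow by (rule arg_cong)
    show ?thesis
      unfolding i
      unfolding lucas_k0 lucas_odd fib_even e
      unfolding sum[OF pn(1)] f S_def power_Suc2[of p "Suc (4 * n + 3)"] by (rule refl)
  qed

  have S_summable: "summable S" and S_suminf: "rogers_dilog p = suminf S"
    using S_sums by (auto simp: sums_iff)
  note split = S_summable S_nonneg
  \<comment> \<open>Splitting by parity, here and once more below, gives the residues 0, 2, 1, 3
    modulo 4, belonging to \<open>A1\<close>, \<open>A2\<close>, \<open>B1\<close>,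
    \<open>B2\<close> in this order.\<close>
  note e = summable_even_terms[OF split] summable_odd_terms[OF split] suminf_even_odd_terms[OF split]
  have idx: "2 * (2 * n) = 4 * n" "2 * (2 * n + 1) = 4 * n + 2" "4 * n + 2 + 1 = 4 * n + 3" for n :: nat
    by simp_all
  note summable_even_terms[OF e(1) S_nonneg] summable_odd_terms[OF e(1) S_nonneg]
    suminf_even_odd_terms[OF e(1) S_nonneg] summable_even_terms[OF e(2) S_nonneg]
    summable_odd_terms[OF e(2) S_nonneg] suminf_even_odd_terms[OF e(2) S_nonneg]
  note this[unfolded idx]
  moreover have "rogers_dilog (1 / \<phi> ^ (2 * k + 1)) = (\<Sum>n. S (2 * n)) + (\<Sum>n. S (2 * n + 1))"
    using S_suminf e(3) by (simp add: p_def assms(1))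
  ultimately show ?thesis
    using goal1 e(1,2) unfolding Let_def A B A1 A2 B1 B2 by (intro conjI) assumption+
qed

end
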